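(* Let $\mathcal{E}$ be a finitely complete and cocomplete category with two weak factorization systems $(\mathbf{C}, \mathbf{TF})$ and $(\mathbf{TC}, \mathbf{F})$ such that $\mathbf{TC} \subseteq \mathbf{C}$ (equivalently $\mathbf{TF} \subseteq \mathbf{F}$). Let $\mathbf{W}$ be the class of maps that factor as a map in $\mathbf{TC}$ followed by a map in $\mathbf{TF}$. Assume: (i) the span property holds; (ii) trivial fibrations satisfy 2-out-of-3 relative to fibrations; (iii) trivial fibrations have exchange along trivial cofibrations; (iv) fibrations have cartesian exchange along trivial cofibrations. Then $(\mathbf{C}, \mathbf{W}, \mathbf{F})$ forms a model structure on $\mathcal{E}$.
   Context: Maps in $\mathbf{C}$, $\mathbf{TC}$, $\mathbf{F}$, $\mathbf{TF}$ are called cofibrations, trivial cofibrations, fibrations, trivial fibrations respectively. Model structure: three classes of maps $\mathbf{C}, \mathbf{W}, \mathbf{F}$ such that $(\mathbf{C}, \mathbf{F} \cap \mathbf{W})$ and $(\mathbf{C} \cap \mathbf{W}, \mathbf{F})$ are weak factorization systems and $\mathbf{W}$ satisfies 2-out-of-3 (factorizations are not required to be functorial). Span property: for any trivial cofibrations $a \colon A \to Y$ and $b \colon A \to X$ and any fibration $p \colon Y \to X$ with $p a = b$, the map $p$ is a trivial fibration. 2-out-of-3 of trivial fibrations relative to fibrations: for fibrations $p \colon Z \to Y$, $q \colon Y \to X$ (so that $qp$ is also a fibration), if two of $p$, $q$, $qp$ are trivial fibrations then so is the third. Exchange: a class of maps $\mathbf{B}$ has exchange along a class of maps $\mathbf{A}$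 if for all $f \colon X \to A$ in $\mathbf{B}$ and $m \colon A \to B$ in $\mathbf{A}$ there are $g \colon Y \to B$ in $\mathbf{B}$ and $n \colon X \to Y$ in $\mathbf{A}$ with $g n = m f$. It has cartesian exchange if this square can in addition be chosen to be a pullback square. *)

theory Defs
  imports Main
begin

section \<open>Categories\<close>

record ('o, 'm) cat =
  Obj :: "'o set"
  Arr :: "'m set"
  Dom :: "'m \<Rightarrow> 'o"
  Cod :: "'m \<Rightarrow> 'o"
  Ident :: "'o \<Rightarrow> 'm"
  Comp :: "'m \<Rightarrow> 'm \<Rightarrow> 'm"  (infixl "\<cdot>\<index>" 70)

text \<open>The composite \<open>g \<cdot>\<^bsub>E\<^esub> f\<close> (first \<open>f\<close>, then \<open>g\<close>) is meaningful only if
  \<open>Cod E f = Dom E g\<close>; likewise the other operations are constrained only on \<open>Obj E\<close>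
  and \<open>Arr E\<close>.\<close>

definition hom :: "('o, 'm) cat \<Rightarrow> 'o \<Rightarrow> 'o \<Rightarrow> 'm set" where
  "hom E A B = {f \<in> Arr E. Dom E f = A \<and> Cod E f = B}"

locale category =
  fixes E :: "('o, 'm) cat" (structure)
  assumes Dom_in_Obj: "f \<in> Arr E \<Longrightarrow> Dom E f \<in> Obj E"
    and Cod_in_Obj: "f \<in> Arr E \<Longrightarrow> Cod E f \<in> Obj E"
    and Ident_in_hom: "A \<in> Obj E \<Longrightarrow> Ident E A \<in> hom E A A"
    and Comp_in_hom: "\<lbrakk>f \<in> hom E A B; g \<in> hom E B D\<rbrakk> \<Longrightarrow> g \<cdot> f \<in> hom E A D"
    and Comp_Ident_right: "f \<in> hom E A B \<Longrightarrow> f \<cdot> Ident E A = f"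
    and Comp_Ident_left: "f \<in> hom E A B \<Longrightarrow> Ident E B \<cdot> f = f"
    and Comp_assoc: "\<lbrakk>f \<in> hom E A B; g \<in> hom E B D; h \<in> hom E D G\<rbrakk>
      \<Longrightarrow> h \<cdot> g \<cdot> f = h \<cdot> (g \<cdot> f)"

definition opposite :: "('o, 'm) cat \<Rightarrow> ('o, 'm) cat" where
  "opposite E = \<lparr>Obj = Obj E, Arr = Arr E, Dom = Cod E, Cod = Dom E, Ident = Ident E,
     Comp = (\<lambda>g f. f \<cdot>\<^bsub>E\<^esub> g)\<rparr>"

lemma hom_opposite: "hom (opposite E) A B = hom E B A"
  by (auto simp: hom_def opposite_def)

lemma category_opposite:
  assumes "category E"
  shows "category (opposite E)"
proof -
  interpret category E by fact
  have c: "g \<cdot>\<^bsub>opposite E\<^esub> f = f \<cdot>\<^bsub>E\<^esub> g" and i: "Ident (opposite E) = Ident E"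
    and o: "Obj (opposite E) = Obj E" for f g
    by (simp_all add: opposite_def)
  show ?thesis
    by unfold_locales
      (auto simp: hom_opposite c i o Ident_in_hom Comp_Ident_left Comp_Ident_right
        Comp_assoc[symmetric] intro: Comp_in_hom,
       auto simp: opposite_def Dom_in_Obj Cod_in_Obj)
qed


section \<open>Finite limits and colimits\<close>

locale functor_between = source: category J + target: category E
  for J :: "('i, 'k) cat" and E :: "('o, 'm) cat" +
  fixes D0 :: "'i \<Rightarrow> 'o" and D1 :: "'k \<Rightarrow> 'm"
  assumes map_Obj: "i \<in> Obj J \<Longrightarrow> D0 i \<in> Obj E"
    and map_Arr: "u \<in> hom J i j \<Longrightarrow> D1 u \<in> hom E (D0 i) (D0 j)"
    and map_Ident: "i \<in> Obj J \<Longrightarrow> D1 (Ident J i) = Ident E (D0 i)"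
    and map_Comp: "\<lbrakk>u \<in> hom J i j; v \<in> hom J j k\<rbrakk> \<Longrightarrow> D1 (v \<cdot>\<^bsub>J\<^esub> u) = D1 v \<cdot>\<^bsub>E\<^esub> D1 u"

definition is_cone ::
  "('i, 'k) cat \<Rightarrow> ('o, 'm) cat \<Rightarrow> ('i \<Rightarrow> 'o) \<Rightarrow> ('k \<Rightarrow> 'm) \<Rightarrow> 'o \<Rightarrow> ('i \<Rightarrow> 'm) \<Rightarrow> bool" where
  "is_cone J E D0 D1 N \<pi> \<longleftrightarrow>
     N \<in> Obj E \<and>
     (\<forall>i\<in>Obj J. \<pi> i \<in> hom E N (D0 i)) \<and>
     (\<forall>u\<in>Arr J. D1 u \<cdot>\<^bsub>E\<^esub> \<pi> (Dom J u) = \<pi> (Cod J u))"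

definition is_limit ::
  "('i, 'k) cat \<Rightarrow> ('o, 'm) cat \<Rightarrow> ('i \<Rightarrow> 'o) \<Rightarrow> ('k \<Rightarrow> 'm) \<Rightarrow> 'o \<Rightarrow> ('i \<Rightarrow> 'm) \<Rightarrow> bool" where
  "is_limit J E D0 D1 L \<pi> \<longleftrightarrow>
     is_cone J E D0 D1 L \<pi> \<and>
     (\<forall>N \<rho>. is_cone J E D0 D1 N \<rho> \<longrightarrow>
        (\<exists>!h. h \<in> hom E N L \<and> (\<forall>i\<in>Obj J. \<pi> i \<cdot>\<^bsub>E\<^esub> h = \<rho> i)))"

text \<open>Every finite category is isomorphic to one whose objects and arrows are natural
  numbers, so it suffices to let the shape range over such categories.\<close>

definition finitely_complete :: "('o, 'm) cat \<Rightarrow> bool" where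
  "finitely_complete E \<longleftrightarrow>
     (\<forall>(J :: (nat, nat) cat) D0 D1.
        finite (Obj J) \<and> finite (Arr J) \<and> functor_between J E D0 D1 \<longrightarrow>
        (\<exists>L \<pi>. is_limit J E D0 D1 L \<pi>))"

definition finitely_cocomplete :: "('o, 'm) cat \<Rightarrow> bool" where
  "finitely_cocomplete E \<longleftrightarrow> finitely_complete (opposite E)"

text \<open>The square with top \<open>n : X \<rightarrow> Y\<close>, left \<open>f : X \<rightarrow> A\<close>, bottom \<open>m : A \<rightarrow> B\<close> and right
  \<open>g : Y \<rightarrow> B\<close> is a pullback.\<close>

definition is_pullback :: "('o, 'm) cat \<Rightarrow> 'm \<Rightarrow> 'm \<Rightarrow> 'm \<Rightarrow> 'm \<Rightarrow> bool" where
  "is_pullback E n f m g \<longleftrightarrow>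
     (\<exists>X A Y B. f \<in> hom E X A \<and> n \<in> hom E X Y \<and> m \<in> hom E A B \<and> g \<in> hom E Y B \<and>
        g \<cdot>\<^bsub>E\<^esub> n = m \<cdot>\<^bsub>E\<^esub> f \<and>
        (\<forall>Z u v. u \<in> hom E Z A \<and> v \<in> hom E Z Y \<and> g \<cdot>\<^bsub>E\<^esub> v = m \<cdot>\<^bsub>E\<^esub> u \<longrightarrow>
           (\<exists>!h. h \<in> hom E Z X \<and> f \<cdot>\<^bsub>E\<^esub> h = u \<and> n \<cdot>\<^bsub>E\<^esub> h = v)))"


section \<open>Weak factorization systems and model structures\<close>

definition has_lifting :: "('o, 'm) cat \<Rightarrow> 'm \<Rightarrow> 'm \<Rightarrow> bool" where
  "has_lifting E l r \<longleftrightarrow>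
     (\<forall>u v. u \<in> hom E (Dom E l) (Dom E r) \<and> v \<in> hom E (Cod E l) (Cod E r) \<and>
        r \<cdot>\<^bsub>E\<^esub> u = v \<cdot>\<^bsub>E\<^esub> l \<longrightarrow>
        (\<exists>h \<in> hom E (Cod E l) (Dom E r). h \<cdot>\<^bsub>E\<^esub> l = u \<and> r \<cdot>\<^bsub>E\<^esub> h = v))"

definition left_lifting_class :: "('o, 'm) cat \<Rightarrow> 'm set \<Rightarrow> 'm set" where
  "left_lifting_class E R = {l \<in> Arr E. \<forall>r\<in>R. has_lifting E l r}"

definition right_lifting_class :: "('o, 'm) cat \<Rightarrow> 'm set \<Rightarrow> 'm set" where
  "right_lifting_class E L = {r \<in> Arr E. \<forall>l\<in>L. has_lifting E l r}"

definition maps_factoring :: "('o, 'm) cat \<Rightarrow> 'm set \<Rightarrow> 'm set \<Rightarrow> 'm set" where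
  "maps_factoring E L R =
     {f \<in> Arr E. \<exists>l\<in>L. \<exists>r\<in>R. \<exists>Y. l \<in> hom E (Dom E f) Y \<and> r \<in> hom E Y (Cod E f) \<and>
        f = r \<cdot>\<^bsub>E\<^esub> l}"

definition weak_factorization_system :: "('o, 'm) cat \<Rightarrow> 'm set \<Rightarrow> 'm set \<Rightarrow> bool" where
  "weak_factorization_system E L R \<longleftrightarrow>
     L = left_lifting_class E R \<and> R = right_lifting_class E L \<and>
     Arr E \<subseteq> maps_factoring E L R"

definition two_out_of_three_relative :: "('o, 'm) cat \<Rightarrow> 'm set \<Rightarrow> 'm set \<Rightarrow> bool" where
  "two_out_of_three_relative E V U \<longleftrightarrow>
     (\<forall>p\<in>U. \<forall>q\<in>U. \<forall>X Y Z. p \<in> hom E Z Y \<and> q \<in> hom E Y X \<longrightarrow>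
        (p \<in> V \<and> q \<in> V \<longrightarrow> q \<cdot>\<^bsub>E\<^esub> p \<in> V) \<and>
        (p \<in> V \<and> q \<cdot>\<^bsub>E\<^esub> p \<in> V \<longrightarrow> q \<in> V) \<and>
        (q \<in> V \<and> q \<cdot>\<^bsub>E\<^esub> p \<in> V \<longrightarrow> p \<in> V))"

definition two_out_of_three :: "('o, 'm) cat \<Rightarrow> 'm set \<Rightarrow> bool" where
  "two_out_of_three E W \<longleftrightarrow> W \<subseteq> Arr E \<and> two_out_of_three_relative E W (Arr E)"

definition model_structure :: "('o, 'm) cat \<Rightarrow> 'm set \<Rightarrow> 'm set \<Rightarrow> 'm set \<Rightarrow> bool" where
  "model_structure E C W F \<longleftrightarrow>
     weak_factorization_system E C (F \<inter> W) \<and>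
     weak_factorization_system E (C \<inter> W) F \<and>
     two_out_of_three E W"


section \<open>The span property and exchange\<close>

definition span_property :: "('o, 'm) cat \<Rightarrow> 'm set \<Rightarrow> 'm set \<Rightarrow> 'm set \<Rightarrow> bool" where
  "span_property E TC F TF \<longleftrightarrow>
     (\<forall>a\<in>TC. \<forall>b\<in>TC. \<forall>p\<in>F. \<forall>A X Y.
        a \<in> hom E A Y \<and> b \<in> hom E A X \<and> p \<in> hom E Y X \<and> p \<cdot>\<^bsub>E\<^esub> a = b \<longrightarrow> p \<in> TF)"

definition has_exchange_along :: "('o, 'm) cat \<Rightarrow> 'm set \<Rightarrow> 'm set \<Rightarrow> bool" where
  "has_exchange_along E \<B> \<A> \<longleftrightarrow>
     (\<forall>f\<in>\<B>. \<forall>m\<in>\<A>. \<forall>X A B. f \<in> hom E X A \<and> m \<in> hom E A B \<longrightarrow>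
        (\<exists>g\<in>\<B>. \<exists>n\<in>\<A>. \<exists>Y. g \<in> hom E Y B \<and> n \<in> hom E X Y \<and>
           g \<cdot>\<^bsub>E\<^esub> n = m \<cdot>\<^bsub>E\<^esub> f))"

definition has_cartesian_exchange_along :: "('o, 'm) cat \<Rightarrow> 'm set \<Rightarrow> 'm set \<Rightarrow> bool" where
  "has_cartesian_exchange_along E \<B> \<A> \<longleftrightarrow>
     (\<forall>f\<in>\<B>. \<forall>m\<in>\<A>. \<forall>X A B. f \<in> hom E X A \<and> m \<in> hom E A B \<longrightarrow>
        (\<exists>g\<in>\<B>. \<exists>n\<in>\<A>. \<exists>Y. g \<in> hom E Y B \<and> n \<in> hom E X Y \<and>
           g \<cdot>\<^bsub>E\<^esub> n = m \<cdot>\<^bsub>E\<^esub> f \<and> is_pullback E n f m g))"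

end

theory Submission
  imports Defs
begin

text \<open>
  The retract argument turns the two given weak factorization systems into the two required
  ones: a fibration in \<open>W\<close> lifts against its own \<open>TC\<close>-part and is thereby a retract of its
  \<open>TF\<close>-part, so \<open>F \<inter> W = TF\<close>; dually \<open>C \<inter> W = TC\<close>.  What remains is 2-out-of-3 for \<open>W\<close>.

  Closure under composition is what exchange of \<open>TF\<close> along \<open>TC\<close> gives: in
  \<open>(t' \<cdot> c') \<cdot> (t \<cdot> c)\<close> the middle part \<open>c' \<cdot> t\<close> can be rewritten as a trivial fibration
  after a trivial cofibration.

  Both cancellation properties rest on one observation (\<open>fibration_trivial_if_composite_in_W\<close>):
  if \<open>p\<close> is a fibration, \<open>a\<close> a trivial cofibration and \<open>p \<cdot> a\<close> lies in \<open>W\<close>, then \<open>p\<close> is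
  a trivial fibration.  To see this, write \<open>p \<cdot> a = t \<cdot> c\<close> and lift \<open>a\<close> against \<open>t\<close>; the
  lift \<open>h\<close> satisfies \<open>h \<cdot> a = c\<close> and \<open>t \<cdot> h = p\<close>.  The fibration part of \<open>h\<close> compares two
  trivial cofibrations, so it is trivial by the span property.  Hence \<open>h\<close> is in \<open>W\<close>, so is
  \<open>p = t \<cdot> h\<close>, and a fibration in \<open>W\<close> is trivial.

  Given a composite \<open>g \<cdot> f\<close> in \<open>W\<close>, exchange brings it into the form \<open>p \<cdot> a\<close> of the
  observation.  If \<open>f\<close> is in \<open>W\<close>, its trivial fibration is moved past the trivial cofibration
  of \<open>g\<close>; if \<open>g\<close> is in \<open>W\<close>, its trivial cofibration is moved past the fibration of \<open>f\<close>.
  In both cases \<open>p\<close> is a composite of two fibrations one of which is known to be trivial, so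
  2-out-of-3 relative to fibrations makes the other one trivial too.  In the second case this
  only concerns the exchanged fibration; since the exchange square is a pullback, triviality
  descends to the fibration of \<open>f\<close> itself.
\<close>

section \<open>Classes of maps defined by lifting\<close>

text \<open>Reversing arrows swaps the two classes of a weak factorization system, so closure
  properties need proof only for the right class.\<close>

lemma has_lifting_opposite: "has_lifting (opposite E) r l \<longleftrightarrow> has_lifting E l r"
proof -
  have op: "Dom (opposite E) = Cod E" "Cod (opposite E) = Dom E"
      "Comp (opposite E) = (\<lambda>g f. f \<cdot>\<^bsub>E\<^esub> g)"
    by (simp_all add: opposite_def)
  show ?thesis
    unfolding has_lifting_def hom_opposite op by (rule iffI; intro allI impI; elim conjE) force+
qed

lemma weak_factorization_system_opposite:
  assumes "weak_factorization_system E L R"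
  shows "weak_factorization_system (opposite E) R L"
proof -
  have Arr: "Arr (opposite E) = Arr E" by (simp add: opposite_def)
  have fact: "maps_factoring (opposite E) R L = maps_factoring E L R"
    unfolding maps_factoring_def hom_opposite by (auto simp: opposite_def)
  have left: "left_lifting_class (opposite E) K = right_lifting_class E K" for K
    by (simp add: left_lifting_class_def right_lifting_class_def has_lifting_opposite Arr)
  have right: "right_lifting_class (opposite E) K = left_lifting_class E K" for K
    by (simp add: left_lifting_class_def right_lifting_class_def has_lifting_opposite Arr)
  from assms show ?thesis
    unfolding weak_factorization_system_def left right fact Arr by (elim conjE) (intro conjI)
qed

lemma has_liftingE:
  assumes lift: "has_lifting E l r" and l: "l \<in> hom E A B" and r: "r \<in> hom E X Y"
    and sq: "u \<in> hom E A X" "v \<in> hom E B Y" "r \<cdot>\<^bsub>E\<^esub> u = v \<cdot>\<^bsub>E\<^esub> l"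
  obtains h where "h \<in> hom E B X" "h \<cdot>\<^bsub>E\<^esub> l = u" "r \<cdot>\<^bsub>E\<^esub> h = v"
proof -
  have ends: "Dom E l = A" "Cod E l = B" "Dom E r = X" "Cod E r = Y"
    using l r by (simp_all add: hom_def)
  from lift sq have "\<exists>h \<in> hom E B X. h \<cdot>\<^bsub>E\<^esub> l = u \<and> r \<cdot>\<^bsub>E\<^esub> h = v"
    unfolding has_lifting_def ends by blast
  then show ?thesis using that by blast
qed

lemma has_liftingI:
  assumes l: "l \<in> hom E A B" and r: "r \<in> hom E X Y"
    and lift: "\<And>u v. \<lbrakk>u \<in> hom E A X; v \<in> hom E B Y; r \<cdot>\<^bsub>E\<^esub> u = v \<cdot>\<^bsub>E\<^esub> l\<rbrakk>
      \<Longrightarrow> \<exists>h \<in> hom E B X. h \<cdot>\<^bsub>E\<^esub> l = u \<and> r \<cdot>\<^bsub>E\<^esub> h = v"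
  shows "has_lifting E l r"
proof -
  have ends: "Dom E l = A" "Cod E l = B" "Dom E r = X" "Cod E r = Y"
    using l r by (simp_all add: hom_def)
  show ?thesis unfolding has_lifting_def ends using lift by blast
qed

lemma homD_Arr: "f \<in> hom E A B \<Longrightarrow> f \<in> Arr E"
  by (simp add: hom_def)

lemma Arr_in_hom: "f \<in> Arr E \<Longrightarrow> f \<in> hom E (Dom E f) (Cod E f)"
  by (simp add: hom_def)

lemma maps_factoringI:
  assumes "l \<in> L" "r \<in> R" "l \<in> hom E A Y" "r \<in> hom E Y B" and f: "r \<cdot>\<^bsub>E\<^esub> l \<in> hom E A B"
  shows "r \<cdot>\<^bsub>E\<^esub> l \<in> maps_factoring E L R"
proof -
  have ends: "r \<cdot>\<^bsub>E\<^esub> l \<in> Arr E" "Dom E (r \<cdot>\<^bsub>E\<^esub> l) = A" "Cod E (r \<cdot>\<^bsub>E\<^esub> l) = B"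
    using f by (simp_all add: hom_def)
  show ?thesis
    unfolding maps_factoring_def mem_Collect_eq ends using ends(1) assms by blast
qed

lemma maps_factoringE:
  assumes "f \<in> maps_factoring E L R" and f: "f \<in> hom E A B"
  obtains l r Y where "l \<in> L" "l \<in> hom E A Y" "r \<in> R" "r \<in> hom E Y B" "f = r \<cdot>\<^bsub>E\<^esub> l"
proof -
  have ends: "Dom E f = A" "Cod E f = B" using f by (simp_all add: hom_def)
  from assms(1) have "\<exists>l\<in>L. \<exists>r\<in>R. \<exists>Y. l \<in> hom E A Y \<and> r \<in> hom E Y B \<and> f = r \<cdot>\<^bsub>E\<^esub> l"
    unfolding maps_factoring_def mem_Collect_eq ends by (rule conjunct2)
  then show ?thesis using that by blast
qed

lemma wfs_left_class: "weak_factorization_system E L R \<Longrightarrow> left_lifting_class E R = L"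
  unfolding weak_factorization_system_def by (elim conjE) (rule sym)

lemma wfs_right_class: "weak_factorization_system E L R \<Longrightarrow> right_lifting_class E L = R"
  unfolding weak_factorization_system_def by (elim conjE) (rule sym)

lemma wfs_lifting:
  assumes wfs: "weak_factorization_system E L R" and "l \<in> L" "r \<in> R"
  shows "has_lifting E l r"
proof -
  have "l \<in> left_lifting_class E R" unfolding wfs_left_class[OF wfs] by fact
  with \<open>r \<in> R\<close> show ?thesis unfolding left_lifting_class_def by blast
qed

lemma wfs_subset_Arr:
  assumes wfs: "weak_factorization_system E L R"
  shows "L \<subseteq> Arr E" "R \<subseteq> Arr E"
proof -
  have "left_lifting_class E R \<subseteq> Arr E" "right_lifting_class E L \<subseteq> Arr E"
    by (auto simp: left_lifting_class_def right_lifting_class_def)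
  then show "L \<subseteq> Arr E" "R \<subseteq> Arr E"
    unfolding wfs_left_class[OF wfs] wfs_right_class[OF wfs] .
qed

lemma wfs_left_hom:
  assumes "weak_factorization_system E L R" "l \<in> L"
  shows "l \<in> hom E (Dom E l) (Cod E l)"
  by (rule Arr_in_hom[OF subsetD[OF wfs_subset_Arr(1)[OF assms(1)] assms(2)]])

lemma wfs_right_hom:
  assumes "weak_factorization_system E L R" "r \<in> R"
  shows "r \<in> hom E (Dom E r) (Cod E r)"
  by (rule Arr_in_hom[OF subsetD[OF wfs_subset_Arr(2)[OF assms(1)] assms(2)]])

lemma wfs_memI:
  assumes wfs: "weak_factorization_system E L R"
    and "f \<in> Arr E" "\<And>l. l \<in> L \<Longrightarrow> has_lifting E l f"
  shows "f \<in> R"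
proof -
  have "f \<in> right_lifting_class E L" using assms(2,3) unfolding right_lifting_class_def by blast
  then show ?thesis unfolding wfs_right_class[OF wfs] .
qed

lemma wfs_factorE:
  assumes wfs: "weak_factorization_system E L R" and f: "f \<in> hom E A B"
  obtains l r Y where "l \<in> L" "l \<in> hom E A Y" "r \<in> R" "r \<in> hom E Y B" "f = r \<cdot>\<^bsub>E\<^esub> l"
proof -
  have "Arr E \<subseteq> maps_factoring E L R"
    using wfs unfolding weak_factorization_system_def by (elim conjE)
  then have "f \<in> maps_factoring E L R" using homD_Arr[OF f] by (rule subsetD)
  then show ?thesis using f that by (rule maps_factoringE)
qed

lemma exchangeE:
  assumes "has_exchange_along E \<B> \<A>" and "f \<in> \<B>" "m \<in> \<A>" "f \<in> hom E X A" "m \<in> hom E A B"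
  obtains g n Y where "g \<in> \<B>" "g \<in> hom E Y B" "n \<in> \<A>" "n \<in> hom E X Y"
    "g \<cdot>\<^bsub>E\<^esub> n = m \<cdot>\<^bsub>E\<^esub> f"
proof -
  have "\<exists>g\<in>\<B>. \<exists>n\<in>\<A>. \<exists>Y. g \<in> hom E Y B \<and> n \<in> hom E X Y \<and> g \<cdot>\<^bsub>E\<^esub> n = m \<cdot>\<^bsub>E\<^esub> f"
    using assms unfolding has_exchange_along_def by blast
  then show ?thesis using that by blast
qed

lemma cartesian_exchangeE:
  assumes "has_cartesian_exchange_along E \<B> \<A>"
    and "f \<in> \<B>" "m \<in> \<A>" "f \<in> hom E X A" "m \<in> hom E A B"
  obtains g n Y where "g \<in> \<B>" "g \<in> hom E Y B" "n \<in> \<A>" "n \<in> hom E X Y"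
    "g \<cdot>\<^bsub>E\<^esub> n = m \<cdot>\<^bsub>E\<^esub> f" "is_pullback E n f m g"
proof -
  have "\<exists>g\<in>\<B>. \<exists>n\<in>\<A>. \<exists>Y. g \<in> hom E Y B \<and> n \<in> hom E X Y \<and> g \<cdot>\<^bsub>E\<^esub> n = m \<cdot>\<^bsub>E\<^esub> f
      \<and> is_pullback E n f m g"
    using assms unfolding has_cartesian_exchange_along_def by blast
  then show ?thesis using that by blast
qed

context category
begin

lemma hom_Obj: "f \<in> hom E A B \<Longrightarrow> A \<in> Obj E" "f \<in> hom E A B \<Longrightarrow> B \<in> Obj E"
  by (auto simp: hom_def Dom_in_Obj Cod_in_Obj)

lemma wfs_Ident_right:
  assumes wfs: "weak_factorization_system E L R" and "A \<in> Obj E"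
  shows "Ident E A \<in> R"
proof (rule wfs_memI[OF wfs])
  show "Ident E A \<in> Arr E" using Ident_in_hom[OF assms(2)] by (rule homD_Arr)
next
  fix l assume "l \<in> L"
  then have l: "l \<in> hom E (Dom E l) (Cod E l)" by (rule wfs_left_hom[OF wfs])
  show "has_lifting E l (Ident E A)"
  proof (rule has_liftingI[OF l Ident_in_hom[OF assms(2)]])
    fix u v assume u: "u \<in> hom E (Dom E l) A" and v: "v \<in> hom E (Cod E l) A"
      and uv: "Ident E A \<cdot> u = v \<cdot> l"
    have "v \<cdot> l = u" using uv Comp_Ident_left[OF u] by simp
    then show "\<exists>h \<in> hom E (Cod E l) A. h \<cdot> l = u \<and> Ident E A \<cdot> h = v"
      using v Comp_Ident_left[OF v] by blast
  qed
qed

lemma wfs_Comp_right: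
  assumes wfs: "weak_factorization_system E L R"
    and R: "p \<in> R" "q \<in> R" and p: "p \<in> hom E Z Y" and q: "q \<in> hom E Y X"
  shows "q \<cdot> p \<in> R"
proof (rule wfs_memI[OF wfs])
  show "q \<cdot> p \<in> Arr E" using Comp_in_hom[OF p q] by (rule homD_Arr)
next
  fix l assume L: "l \<in> L"
  then have l: "l \<in> hom E (Dom E l) (Cod E l)" by (rule wfs_left_hom[OF wfs])
  show "has_lifting E l (q \<cdot> p)"
  proof (rule has_liftingI[OF l Comp_in_hom[OF p q]])
    fix u v assume u: "u \<in> hom E (Dom E l) Z" and v: "v \<in> hom E (Cod E l) X"
      and sq: "q \<cdot> p \<cdot> u = v \<cdot> l"
    have sq': "q \<cdot> (p \<cdot> u) = v \<cdot> l" using sq Comp_assoc[OF u p q] by simp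
    obtain k where k: "k \<in> hom E (Cod E l) Y" "k \<cdot> l = p \<cdot> u" "q \<cdot> k = v"
      by (rule has_liftingE[OF wfs_lifting[OF wfs L R(2)] l q Comp_in_hom[OF u p] v sq'])
    obtain h where h: "h \<in> hom E (Cod E l) Z" "h \<cdot> l = u" "p \<cdot> h = k"
      by (rule has_liftingE[OF wfs_lifting[OF wfs L R(1)] l p u k(1) k(2)[symmetric]])
    have "q \<cdot> p \<cdot> h = v" using Comp_assoc[OF h(1) p q] h k by simp
    then show "\<exists>h \<in> hom E (Cod E l) Z. h \<cdot> l = u \<and> q \<cdot> p \<cdot> h = v" using h by blast
  qed
qed

lemma wfs_pullback_right:
  assumes wfs: "weak_factorization_system E L R"
    and g: "g \<in> R" and pb: "is_pullback E n f m g"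
  shows "f \<in> R"
proof (rule wfs_memI[OF wfs])
  show "f \<in> Arr E" using pb by (auto simp: is_pullback_def hom_def)
next
  fix l assume L: "l \<in> L"
  then have l: "l \<in> hom E (Dom E l) (Cod E l)" by (rule wfs_left_hom[OF wfs])
  obtain X A Y B where fh: "f \<in> hom E X A" and nh: "n \<in> hom E X Y" and mh: "m \<in> hom E A B"
    and gh: "g \<in> hom E Y B" and sq: "g \<cdot> n = m \<cdot> f"
    and univ: "\<And>Z u v. \<lbrakk>u \<in> hom E Z A; v \<in> hom E Z Y; g \<cdot> v = m \<cdot> u\<rbrakk> \<Longrightarrow>
           \<exists>!h. h \<in> hom E Z X \<and> f \<cdot> h = u \<and> n \<cdot> h = v"
    using pb unfolding is_pullback_def by blast
  show "has_lifting E l f"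
  proof (rule has_liftingI[OF l fh])
    fix u v assume u: "u \<in> hom E (Dom E l) X" and v: "v \<in> hom E (Cod E l) A"
      and uv: "f \<cdot> u = v \<cdot> l"
    have *: "g \<cdot> (n \<cdot> u) = m \<cdot> v \<cdot> l"
      using Comp_assoc[OF u nh gh] Comp_assoc[OF u fh mh] Comp_assoc[OF l v mh] sq uv by simp
    obtain k where k: "k \<in> hom E (Cod E l) Y" "k \<cdot> l = n \<cdot> u" "g \<cdot> k = m \<cdot> v"
      by (rule has_liftingE[OF wfs_lifting[OF wfs L g] l gh Comp_in_hom[OF u nh] Comp_in_hom[OF v mh] *])
    obtain h where h: "h \<in> hom E (Cod E l) X" "f \<cdot> h = v" "n \<cdot> h = k"
      using univ[OF v k(1) k(3)] by blast
    have "m \<cdot> (f \<cdot> u) = g \<cdot> (n \<cdot> u)"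
      using Comp_assoc[OF u nh gh] Comp_assoc[OF u fh mh] sq by simp
    \<comment> \<open>The upper triangle commutes because both maps have the same components.\<close>
    then have unique: "\<exists>!x. x \<in> hom E (Dom E l) X \<and> f \<cdot> x = f \<cdot> u \<and> n \<cdot> x = n \<cdot> u"
      by (intro univ[OF Comp_in_hom[OF u fh] Comp_in_hom[OF u nh]]) (rule sym)
    have "f \<cdot> (h \<cdot> l) = f \<cdot> u" "n \<cdot> (h \<cdot> l) = n \<cdot> u"
      using Comp_assoc[OF l h(1) fh] Comp_assoc[OF l h(1) nh] h uv k(2) by simp_all
    then have "h \<cdot> l = u"
      using unique Comp_in_hom[OF l h(1)] u by blast
    then show "\<exists>h \<in> hom E (Cod E l) X. h \<cdot> l = u \<and> f \<cdot> h = v" using h by blast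
  qed
qed

text \<open>The retract argument: lifting \<open>i\<close> against \<open>f = r \<cdot> i\<close> gives a map \<open>s\<close> with
  \<open>s \<cdot> i\<close> an identity and \<open>f \<cdot> s = r\<close>.  Thus \<open>f\<close> is a retract of \<open>r\<close>, and a lift against
  \<open>r\<close> becomes one against \<open>f\<close> after composing with \<open>s\<close>.\<close>

lemma wfs_retract_argument_right:
  assumes wfs: "weak_factorization_system E L R"
    and r: "r \<in> R" and ih: "i \<in> hom E A Y" and rh: "r \<in> hom E Y B"
    and lift: "has_lifting E i (r \<cdot> i)"
  shows "r \<cdot> i \<in> R"
proof (rule wfs_memI[OF wfs])
  have fh: "r \<cdot> i \<in> hom E A B" using Comp_in_hom[OF ih rh] .
  then show "r \<cdot> i \<in> Arr E" by (rule homD_Arr)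
  have idA: "Ident E A \<in> hom E A A" using Ident_in_hom hom_Obj(1)[OF ih] by blast
  obtain s where s: "s \<in> hom E Y A" "s \<cdot> i = Ident E A" "r \<cdot> i \<cdot> s = r"
    by (rule has_liftingE[OF lift ih fh idA rh Comp_Ident_right[OF fh]])
  fix l assume L: "l \<in> L"
  then have l: "l \<in> hom E (Dom E l) (Cod E l)" by (rule wfs_left_hom[OF wfs])
  show "has_lifting E l (r \<cdot> i)"
  proof (rule has_liftingI[OF l fh])
    fix u v assume u: "u \<in> hom E (Dom E l) A" and v: "v \<in> hom E (Cod E l) B"
      and uv: "r \<cdot> i \<cdot> u = v \<cdot> l"
    have *: "r \<cdot> (i \<cdot> u) = v \<cdot> l" using uv Comp_assoc[OF u ih rh] by simp
    obtain k where k: "k \<in> hom E (Cod E l) Y" "k \<cdot> l = i \<cdot> u" "r \<cdot> k = v"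
      by (rule has_liftingE[OF wfs_lifting[OF wfs L r] l rh Comp_in_hom[OF u ih] v *])
    have "s \<cdot> k \<cdot> l = u"
      using Comp_assoc[OF l k(1) s(1)] Comp_assoc[OF u ih s(1)] k s Comp_Ident_left[OF u] by simp
    moreover have "r \<cdot> i \<cdot> (s \<cdot> k) = v"
      using Comp_assoc[OF k(1) s(1) fh] s k by simp
    ultimately show "\<exists>h \<in> hom E (Cod E l) A. h \<cdot> l = u \<and> r \<cdot> i \<cdot> h = v"
      using Comp_in_hom[OF k(1) s(1)] by blast
  qed
qed

lemma wfs_Ident_left:
  assumes "weak_factorization_system E L R" "A \<in> Obj E"
  shows "Ident E A \<in> L"
  using category.wfs_Ident_right[OF category_opposite[OF category_axioms]
      weak_factorization_system_opposite[OF assms(1)]] assms(2)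
  by (simp add: opposite_def)

lemma wfs_Comp_left:
  assumes "weak_factorization_system E L R"
    and "a \<in> L" "b \<in> L" "a \<in> hom E A B" "b \<in> hom E B D"
  shows "b \<cdot> a \<in> L"
  using category.wfs_Comp_right[OF category_opposite[OF category_axioms]
      weak_factorization_system_opposite[OF assms(1)] assms(3,2),
      unfolded hom_opposite, OF assms(5,4)]
  by (simp add: opposite_def)

lemma wfs_retract_argument_left:
  assumes "weak_factorization_system E L R"
    and "i \<in> L" "i \<in> hom E A Y" "r \<in> hom E Y B" "has_lifting E (r \<cdot> i) r"
  shows "r \<cdot> i \<in> L"
  using category.wfs_retract_argument_right[OF category_opposite[OF category_axioms]
      weak_factorization_system_opposite[OF assms(1)] assms(2),
      unfolded hom_opposite has_lifting_opposite, OF assms(4,3)] assms(5)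
  using has_lifting_opposite[of E r "r \<cdot> i"] by (simp add: opposite_def)

end


section \<open>Trivial cofibrations followed by trivial fibrations\<close>

locale two_wfs = category +
  fixes C TC F TF :: "'b set"
  assumes wfs_C_TF: "weak_factorization_system E C TF"
    and wfs_TC_F: "weak_factorization_system E TC F"
    and TC_subset_C: "TC \<subseteq> C"
begin

abbreviation W where "W \<equiv> maps_factoring E TC TF"

lemma TF_subset_F: "TF \<subseteq> F"
proof
  fix t assume t: "t \<in> TF"
  show "t \<in> F"
    using wfs_lifting[OF wfs_C_TF _ t] TC_subset_C wfs_subset_Arr(2)[OF wfs_C_TF] t
    by (intro wfs_memI[OF wfs_TC_F]) auto
qed

lemma Comp_in_W: "\<lbrakk>c \<in> TC; t \<in> TF; c \<in> hom E A Y; t \<in> hom E Y B\<rbrakk> \<Longrightarrow> t \<cdot> c \<in> W"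
  by (rule maps_factoringI[OF _ _ _ _ Comp_in_hom])

lemma TF_subset_W: "TF \<subseteq> W"
proof
  fix t assume t: "t \<in> TF"
  then have h: "t \<in> hom E (Dom E t) (Cod E t)" by (rule wfs_right_hom[OF wfs_C_TF])
  show "t \<in> W"
    using Comp_in_W[OF wfs_Ident_left[OF wfs_TC_F] t Ident_in_hom h] hom_Obj(1)[OF h]
      Comp_Ident_right[OF h] by simp
qed

lemma TC_subset_W: "TC \<subseteq> W"
proof
  fix c assume c: "c \<in> TC"
  then have h: "c \<in> hom E (Dom E c) (Cod E c)" by (rule wfs_left_hom[OF wfs_TC_F])
  show "c \<in> W"
    using Comp_in_W[OF c wfs_Ident_right[OF wfs_C_TF] h Ident_in_hom] hom_Obj(2)[OF h]
      Comp_Ident_left[OF h] by simp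
qed

lemma F_Int_W: "F \<inter> W = TF"
proof
  show "TF \<subseteq> F \<inter> W" using TF_subset_F TF_subset_W by blast
  show "F \<inter> W \<subseteq> TF"
  proof
    fix f assume f: "f \<in> F \<inter> W"
    have fh: "f \<in> hom E (Dom E f) (Cod E f)" by (rule wfs_right_hom[OF wfs_TC_F IntD1[OF f]])
    obtain c t Y where c: "c \<in> TC" "c \<in> hom E (Dom E f) Y" and t: "t \<in> TF" "t \<in> hom E Y (Cod E f)"
      and f_eq: "f = t \<cdot> c" by (rule maps_factoringE[OF IntD2[OF f] fh])
    have "has_lifting E c (t \<cdot> c)"
      using wfs_lifting[OF wfs_TC_F c(1) IntD1[OF f]] unfolding f_eq .
    then show "f \<in> TF"
      unfolding f_eq by (rule wfs_retract_argument_right[OF wfs_C_TF t(1) c(2) t(2)])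
  qed
qed

lemma C_Int_W: "C \<inter> W = TC"
proof
  show "TC \<subseteq> C \<inter> W" using TC_subset_C TC_subset_W by blast
  show "C \<inter> W \<subseteq> TC"
  proof
    fix f assume f: "f \<in> C \<inter> W"
    have fh: "f \<in> hom E (Dom E f) (Cod E f)" by (rule wfs_left_hom[OF wfs_C_TF IntD1[OF f]])
    obtain c t Y where c: "c \<in> TC" "c \<in> hom E (Dom E f) Y" and t: "t \<in> TF" "t \<in> hom E Y (Cod E f)"
      and f_eq: "f = t \<cdot> c" by (rule maps_factoringE[OF IntD2[OF f] fh])
    have "has_lifting E (t \<cdot> c) t"
      using wfs_lifting[OF wfs_C_TF IntD1[OF f] t(1)] unfolding f_eq .
    then show "f \<in> TC"
      unfolding f_eq by (rule wfs_retract_argument_left[OF wfs_TC_F c t(2)])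
  qed
qed

lemma trivial_fibration_after_W_in_W:
  assumes "w \<in> W" "t \<in> TF" and w: "w \<in> hom E A B" and t: "t \<in> hom E B D"
  shows "t \<cdot> w \<in> W"
proof -
  obtain c s Y where c: "c \<in> TC" "c \<in> hom E A Y" and s: "s \<in> TF" "s \<in> hom E Y B"
    and w_eq: "w = s \<cdot> c"
    by (rule maps_factoringE[OF assms(1) w])
  have "t \<cdot> s \<in> TF" using wfs_Comp_right[OF wfs_C_TF s(1) assms(2) s(2) t] .
  then have "t \<cdot> s \<cdot> c \<in> W" using Comp_in_W[OF c(1) _ c(2) Comp_in_hom[OF s(2) t]] by blast
  then show ?thesis using Comp_assoc[OF c(2) s(2) t] w_eq by simp
qed

lemma fibration_trivial_if_composite_in_W:
  assumes span: "span_property E TC F TF"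
    and TC: "a \<in> TC" and F: "p \<in> F" and W: "p \<cdot> a \<in> W"
    and a: "a \<in> hom E A Y" and p: "p \<in> hom E Y X"
  shows "p \<in> TF"
proof -
  obtain c t V where c: "c \<in> TC" "c \<in> hom E A V" and t: "t \<in> TF" "t \<in> hom E V X"
    and pa: "p \<cdot> a = t \<cdot> c"
    by (rule maps_factoringE[OF W Comp_in_hom[OF a p]])
  have "has_lifting E a t" using wfs_lifting[OF wfs_TC_F TC] TF_subset_F t(1) by blast
  then obtain h where h: "h \<in> hom E Y V" "h \<cdot> a = c" "t \<cdot> h = p"
    by (rule has_liftingE[OF _ a t(2) c(2) p pa[symmetric]])
  obtain j q U where j: "j \<in> TC" "j \<in> hom E Y U" and q: "q \<in> F" "q \<in> hom E U V"
    and h_eq: "h = q \<cdot> j"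
    by (rule wfs_factorE[OF wfs_TC_F h(1)])
  \<comment> \<open>The fibration \<open>q\<close> sits under the span of trivial cofibrations \<open>j \<cdot> a\<close> and \<open>c\<close>.\<close>
  have "j \<cdot> a \<in> TC" using wfs_Comp_left[OF wfs_TC_F TC j(1) a j(2)] .
  moreover have "q \<cdot> (j \<cdot> a) = c" using Comp_assoc[OF a j(2) q(2)] h h_eq by simp
  ultimately have "q \<in> TF"
    using span Comp_in_hom[OF a j(2)] q c unfolding span_property_def by blast
  then have "h \<in> W" using Comp_in_W[OF j(1) _ j(2) q(2)] h_eq by simp
  then have "p \<in> W" using trivial_fibration_after_W_in_W[OF _ t(1) h(1) t(2)] h(3) by simp
  then show ?thesis using F F_Int_W by blast
qed


section \<open>Two-out-of-three\<close>

text \<open>Exchange swaps the trivial fibration of \<open>f\<close> with the trivial cofibration of \<open>g\<close>.\<close>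

lemma W_Comp:
  assumes exchange: "has_exchange_along E TF TC"
    and "f \<in> W" "g \<in> W" and f: "f \<in> hom E X Y" and g: "g \<in> hom E Y Z"
  shows "g \<cdot> f \<in> W"
proof -
  obtain c t V where c: "c \<in> TC" "c \<in> hom E X V" and t: "t \<in> TF" "t \<in> hom E V Y"
    and f_eq: "f = t \<cdot> c"
    by (rule maps_factoringE[OF assms(2) f])
  obtain c' t' V' where c': "c' \<in> TC" "c' \<in> hom E Y V'" and t': "t' \<in> TF" "t' \<in> hom E V' Z"
    and g_eq: "g = t' \<cdot> c'"
    by (rule maps_factoringE[OF assms(3) g])
  obtain s n U where s: "s \<in> TF" "s \<in> hom E U V'" and n: "n \<in> TC" "n \<in> hom E V U"
    and sn: "s \<cdot> n = c' \<cdot> t"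
    by (rule exchangeE[OF exchange t(1) c'(1) t(2) c'(2)])
  have "n \<cdot> c \<in> TC" using wfs_Comp_left[OF wfs_TC_F c(1) n(1) c(2) n(2)] .
  then have "s \<cdot> (n \<cdot> c) \<in> W" using Comp_in_W s Comp_in_hom[OF c(2) n(2)] by blast
  then have "c' \<cdot> f \<in> W"
    using Comp_assoc[OF c(2) n(2) s(2)] Comp_assoc[OF c(2) t(2) c'(2)] sn f_eq by simp
  then have "t' \<cdot> (c' \<cdot> f) \<in> W"
    using trivial_fibration_after_W_in_W[OF _ t'(1) Comp_in_hom[OF f c'(2)] t'(2)] by blast
  then show ?thesis using Comp_assoc[OF f c'(2) t'(2)] g_eq by simp
qed

text \<open>With \<open>f = t \<cdot> c\<close> and \<open>g = p \<cdot> j\<close>, exchanging \<open>j \<cdot> t\<close> for \<open>s \<cdot> n\<close> rewrites the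
  composite as the fibration \<open>p \<cdot> s\<close> after a trivial cofibration.  So \<open>p \<cdot> s\<close> is trivial,
  and with \<open>s\<close> also \<open>p\<close>.\<close>

lemma W_cancel_right:
  assumes span: "span_property E TC F TF"
    and two_of_three: "two_out_of_three_relative E TF F"
    and exchange: "has_exchange_along E TF TC"
    and "f \<in> W" "g \<cdot> f \<in> W" and f: "f \<in> hom E X Y" and g: "g \<in> hom E Y Z"
  shows "g \<in> W"
proof -
  obtain c t V where c: "c \<in> TC" "c \<in> hom E X V" and t: "t \<in> TF" "t \<in> hom E V Y"
    and f_eq: "f = t \<cdot> c"
    by (rule maps_factoringE[OF assms(4) f])
  obtain j p U where j: "j \<in> TC" "j \<in> hom E Y U" and p: "p \<in> F" "p \<in> hom E U Z"
    and g_eq: "g = p \<cdot> j"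
    by (rule wfs_factorE[OF wfs_TC_F g])
  obtain s n V' where s: "s \<in> TF" "s \<in> hom E V' U" and n: "n \<in> TC" "n \<in> hom E V V'"
    and sn: "s \<cdot> n = j \<cdot> t"
    by (rule exchangeE[OF exchange t(1) j(1) t(2) j(2)])
  have sF: "s \<in> F" using s(1) TF_subset_F by blast
  have nc: "n \<cdot> c \<in> hom E X V'" using Comp_in_hom[OF c(2) n(2)] .
  have "p \<cdot> s \<cdot> (n \<cdot> c) = p \<cdot> (s \<cdot> (n \<cdot> c))" using Comp_assoc[OF nc s(2) p(2)] .
  also have "s \<cdot> (n \<cdot> c) = j \<cdot> f"
    using Comp_assoc[OF c(2) n(2) s(2)] Comp_assoc[OF c(2) t(2) j(2)] sn f_eq by simp
  also have "p \<cdot> (j \<cdot> f) = g \<cdot> f" using Comp_assoc[OF f j(2) p(2)] g_eq by simp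
  finally have "p \<cdot> s \<cdot> (n \<cdot> c) \<in> W" using assms(5) by simp
  then have "p \<cdot> s \<in> TF"
    using fibration_trivial_if_composite_in_W[OF span
        wfs_Comp_left[OF wfs_TC_F c(1) n(1) c(2) n(2)]
        wfs_Comp_right[OF wfs_TC_F sF p(1) s(2) p(2)] _ nc Comp_in_hom[OF s(2) p(2)]]
    by blast
  then have "p \<in> TF"
    using two_of_three s sF p unfolding two_out_of_three_relative_def by blast
  then show ?thesis using Comp_in_W[OF j(1) _ j(2) p(2)] g_eq by simp
qed

text \<open>With \<open>f = p \<cdot> j\<close> and \<open>g = t \<cdot> c\<close>, exchanging \<open>c \<cdot> p\<close> for \<open>q \<cdot> n\<close> rewrites the
  composite as the fibration \<open>t \<cdot> q\<close> after a trivial cofibration.  So \<open>t \<cdot> q\<close> is trivial,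
  and with \<open>t\<close> also \<open>q\<close>.  It is \<open>p\<close> that has to be trivial, however; this is where the
  exchange has to be cartesian, making \<open>p\<close> a pullback of \<open>q\<close>.\<close>

lemma W_cancel_left:
  assumes span: "span_property E TC F TF"
    and two_of_three: "two_out_of_three_relative E TF F"
    and cartesian_exchange: "has_cartesian_exchange_along E F TC"
    and "g \<in> W" "g \<cdot> f \<in> W" and f: "f \<in> hom E X Y" and g: "g \<in> hom E Y Z"
  shows "f \<in> W"
proof -
  obtain c t V where c: "c \<in> TC" "c \<in> hom E Y V" and t: "t \<in> TF" "t \<in> hom E V Z"
    and g_eq: "g = t \<cdot> c"
    by (rule maps_factoringE[OF assms(4) g])
  obtain j p U where j: "j \<in> TC" "j \<in> hom E X U" and p: "p \<in> F" "p \<in> hom E U Y"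
    and f_eq: "f = p \<cdot> j"
    by (rule wfs_factorE[OF wfs_TC_F f])
  obtain q n U' where q: "q \<in> F" "q \<in> hom E U' V" and n: "n \<in> TC" "n \<in> hom E U U'"
    and qn: "q \<cdot> n = c \<cdot> p" and pb: "is_pullback E n p c q"
    by (rule cartesian_exchangeE[OF cartesian_exchange p(1) c(1) p(2) c(2)])
  have tF: "t \<in> F" using t(1) TF_subset_F by blast
  have nj: "n \<cdot> j \<in> hom E X U'" using Comp_in_hom[OF j(2) n(2)] .
  have "t \<cdot> q \<cdot> (n \<cdot> j) = t \<cdot> (q \<cdot> (n \<cdot> j))" using Comp_assoc[OF nj q(2) t(2)] .
  also have "q \<cdot> (n \<cdot> j) = c \<cdot> f"
    using Comp_assoc[OF j(2) n(2) q(2)] Comp_assoc[OF j(2) p(2) c(2)] qn f_eq by simp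
  also have "t \<cdot> (c \<cdot> f) = g \<cdot> f" using Comp_assoc[OF f c(2) t(2)] g_eq by simp
  finally have "t \<cdot> q \<cdot> (n \<cdot> j) \<in> W" using assms(5) by simp
  then have "t \<cdot> q \<in> TF"
    using fibration_trivial_if_composite_in_W[OF span
        wfs_Comp_left[OF wfs_TC_F j(1) n(1) j(2) n(2)]
        wfs_Comp_right[OF wfs_TC_F q(1) tF q(2) t(2)] _ nj Comp_in_hom[OF q(2) t(2)]]
    by blast
  then have "q \<in> TF"
    using two_of_three t tF q unfolding two_out_of_three_relative_def by blast
  then have "p \<in> TF" using wfs_pullback_right[OF wfs_C_TF _ pb] by blast
  then show ?thesis using Comp_in_W[OF j(1) _ j(2) p(2)] f_eq by simp
qed

end

section \<open>The model structure\<close>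

theorem theorem2p6:
  fixes E :: "('o, 'm) cat"
    and C TC F TF W :: "'m set"
  assumes "category E"
    and "finitely_complete E"
    and "finitely_cocomplete E"
    and "weak_factorization_system E C TF"
    and "weak_factorization_system E TC F"
    and "TC \<subseteq> C"
    and W_def: "W = maps_factoring E TC TF"
    and span: "span_property E TC F TF"
    and two_of_three: "two_out_of_three_relative E TF F"
    and exchange: "has_exchange_along E TF TC"
    and cartesian_exchange: "has_cartesian_exchange_along E F TC"
  shows "model_structure E C W F"
proof -
  interpret category E by fact
  interpret two_wfs E C TC F TF by unfold_locales fact+
  have "two_out_of_three E W"
    unfolding two_out_of_three_def two_out_of_three_relative_def W_def
  proof (intro conjI ballI allI impI; (elim conjE)?)
    show "maps_factoring E TC TF \<subseteq> Arr E" by (auto simp: maps_factoring_def)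
  next
    fix p q X Y Z assume pq: "p \<in> hom E Z Y" "q \<in> hom E Y X"
    show "q \<cdot>\<^bsub>E\<^esub> p \<in> maps_factoring E TC TF"
      if "p \<in> maps_factoring E TC TF" "q \<in> maps_factoring E TC TF"
      using W_Comp[OF exchange that pq] .
    show "q \<in> maps_factoring E TC TF"
      if "p \<in> maps_factoring E TC TF" "q \<cdot>\<^bsub>E\<^esub> p \<in> maps_factoring E TC TF"
      using W_cancel_right[OF span two_of_three exchange that pq] .
    show "p \<in> maps_factoring E TC TF"
      if "q \<in> maps_factoring E TC TF" "q \<cdot>\<^bsub>E\<^esub> p \<in> maps_factoring E TC TF"
      using W_cancel_left[OF span two_of_three cartesian_exchange that pq] .
  qed
  then show ?thesis
    unfolding model_structure_def W_def F_Int_W C_Int_W using wfs_C_TF wfs_TC_F by blast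
qed

end
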